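(* Let $K$ be a field of any characteristic and let $\mathcal L$ be a set of $b\ge3$ skew lines in $\mathbb P^3_K$ with two distinct transversals such that $|G_{\mathcal L}|>1$. Let $r\ge1$ be an integer. (a) If $b>\frac{2r(r-1)(r-2)}{3}+2$, then $|G_{\mathcal L}|>r$. (b) If $b>2\left(\sum_{m=1}^r n_m\right)+2$, then $|G_{\mathcal L}|>r$.
   Context: For distinct lines $L_i,L_j,L_k\in\mathcal L$ let $f_{ijk}\colon L_i\to L_j$ be the linear isomorphism sending $q\in L_i$ to the point where the plane spanned by $q$ and $L_k$ meets $L_j$. The groupoid $C_{\mathcal L}$ has the lines $L_i$ as objects and all possible compositions of the maps $f_{ijk}$ as arrows. The groups $\mathrm{Hom}_{C_{\mathcal L}}(L_i,L_i)$ are all isomorphic, and $G_{\mathcal L}$ denotes any of them. A transversal for $\mathcal L$ is a line meeting every line of $\mathcal L$. The integers $n_m$: let $p=\mathrm{char}(K)$. Set $n_1=0$. For $m>1$ with prime factorization $m=p_1^{e_1}\cdots p_t^{e_t}$ (distinct primes $p_k$, $e_k\ge1$): if $p>0$ and $p\mid m$, then $n_m=0$; otherwise, with $\phi$ Euler's totient function, $$n_m=\phi(m)(\phi(m)-1)+2\phi(m)(m-1-\phi(m))+\phi(m)\sum_S\Big(\prod_{k\in S}p_k^{e_k-1}\Big)\Big(\prod_{k\notin S}p_k^{e_k}-\prod_{k\notin S}\phi(p_k^{e_k})\Big),$$ where the sum is over all nonempty proper subsets $S\subsetneq\{1,\dots,t\}$. (For $m>1$, $n_m$ is the number of lines $L_4$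 meeting two given distinct transversals of three given skew lines $L_1,L_2,L_3$ over $\overline K$ such that the group of $\{L_1,L_2,L_3,L_4\}$ has order $m$.) *)

theory Defs
  imports
    "HOL-Analysis.Cartesian_Space"
    "HOL-Library.Extended_Nat"
    "HOL-Library.FuncSet"
    "HOL-Algebra.Coset"
    "HOL-Number_Theory.Totient"
begin

text \<open>
  Projective 3-space over a field \<open>K\<close>, given by a type \<open>'a\<close> of class \<open>field\<close>, is the
  projectivisation of \<open>K^4\<close>: points and lines are linear subspaces of dimension 1 and 2,
  and incidence is inclusion.
\<close>

definition proj_point :: "('a::field ^ 4) set \<Rightarrow> bool" where
  "proj_point P \<longleftrightarrow> vec.subspace P \<and> vec.dim P = 1"

definition proj_line :: "('a::field ^ 4) set \<Rightarrow> bool" where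
  "proj_line L \<longleftrightarrow> vec.subspace L \<and> vec.dim L = 2"

definition points_on :: "('a::field ^ 4) set \<Rightarrow> ('a ^ 4) set set" where
  "points_on L = {P. proj_point P \<and> P \<subseteq> L}"

definition lines_meet :: "('a::field ^ 4) set \<Rightarrow> ('a ^ 4) set \<Rightarrow> bool" where
  "lines_meet L M \<longleftrightarrow> points_on L \<inter> points_on M \<noteq> {}"

definition skew_lines :: "('a::field ^ 4) set set \<Rightarrow> bool" where
  "skew_lines \<L> \<longleftrightarrow> (\<forall>L\<in>\<L>. proj_line L) \<and> pairwise (\<lambda>L M. \<not> lines_meet L M) \<L>"

definition is_transversal :: "('a::field ^ 4) set set \<Rightarrow> ('a ^ 4) set \<Rightarrow> bool" where
  "is_transversal \<L> T \<longleftrightarrow> proj_line T \<and> (\<forall>L\<in>\<L>. lines_meet T L)"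

text \<open>
  The map \<open>f\<^sub>i\<^sub>j\<^sub>k\<close> is \<open>line_proj L\<^sub>i L\<^sub>j L\<^sub>k\<close>. For pairwise skew lines \<open>vec.span (q \<union> L\<^sub>k)\<close>
  has dimension 3 and meets \<open>L\<^sub>j\<close> in a one-dimensional subspace. The map is undefined off
  \<open>L\<^sub>i\<close>, so that two maps are equal iff they agree on \<open>L\<^sub>i\<close>. Points rational over \<open>K\<close>
  suffice here, since an isomorphism of projective lines is determined by its
  values on three rational points.
\<close>

definition line_proj ::
  "('a::field ^ 4) set \<Rightarrow> ('a ^ 4) set \<Rightarrow> ('a ^ 4) set \<Rightarrow> ('a ^ 4) set \<Rightarrow> ('a ^ 4) set" where
  "line_proj L\<^sub>i L\<^sub>j L\<^sub>k = (\<lambda>q\<in>points_on L\<^sub>i. vec.span (q \<union> L\<^sub>k) \<inter> L\<^sub>j)"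

inductive groupoid_arrow ::
  "('a::field ^ 4) set set \<Rightarrow> ('a ^ 4) set \<Rightarrow> ('a ^ 4) set \<Rightarrow>
    (('a ^ 4) set \<Rightarrow> ('a ^ 4) set) \<Rightarrow> bool" for \<L> where
  proj: "\<lbrakk>L\<^sub>i \<in> \<L>; L\<^sub>j \<in> \<L>; L\<^sub>k \<in> \<L>; L\<^sub>i \<noteq> L\<^sub>j; L\<^sub>j \<noteq> L\<^sub>k; L\<^sub>i \<noteq> L\<^sub>k\<rbrakk>
    \<Longrightarrow> groupoid_arrow \<L> L\<^sub>i L\<^sub>j (line_proj L\<^sub>i L\<^sub>j L\<^sub>k)"
| ident: "L \<in> \<L> \<Longrightarrow> groupoid_arrow \<L> L L (\<lambda>q\<in>points_on L. q)"
| comp: "\<lbrakk>groupoid_arrow \<L> L M f; groupoid_arrow \<L> M N g\<rbrakk>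
    \<Longrightarrow> groupoid_arrow \<L> L N (compose (points_on L) g f)"

definition vertex_group ::
  "('a::field ^ 4) set set \<Rightarrow> ('a ^ 4) set \<Rightarrow> (('a ^ 4) set \<Rightarrow> ('a ^ 4) set) monoid" where
  "vertex_group \<L> L =
    \<lparr>carrier = {f. groupoid_arrow \<L> L L f},
     monoid.mult = (\<lambda>g f. compose (points_on L) g f),
     one = (\<lambda>q\<in>points_on L. q)\<rparr>"

text \<open>The library's \<open>order\<close> is 0 for infinite groups; this version is \<open>\<infinity>\<close> there.\<close>

definition group_card :: "('g, 'm) monoid_scheme \<Rightarrow> enat" where
  "group_card G = (if finite (carrier G) then enat (order G) else \<infinity>)"

text \<open>
  The integers \<open>n\<^sub>m\<close> in characteristic \<open>p\<close> (\<open>p = 0\<close> included). The index set of the prime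
  factorization is the set of primes dividing \<open>m\<close> itself.
\<close>

definition num_lines :: "nat \<Rightarrow> nat \<Rightarrow> int" where
  "num_lines p m =
    (if m \<le> 1 \<or> (p > 0 \<and> p dvd m) then 0
     else
       let \<phi> = int (totient m); e = (\<lambda>q. multiplicity q m) in
         \<phi> * (\<phi> - 1) + 2 * \<phi> * (int m - 1 - \<phi>)
         + \<phi> * (\<Sum>S \<in> {S. S \<noteq> {} \<and> S \<subset> prime_factors m}.
             (\<Prod>q\<in>S. int (q ^ (e q - 1)))
             * ((\<Prod>q \<in> prime_factors m - S. int (q ^ e q))
                - (\<Prod>q \<in> prime_factors m - S. int (totient (q ^ e q))))))"

end

theory Submission
  imports Defs "HOL-Computational_Algebra.Polynomial"
begin

text \<open>
  The two transversals \<open>T\<^sub>1\<close>, \<open>T\<^sub>2\<close> are skew, so a line of \<open>\<L>\<close> is a pair of points, one on each of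
  them. With \<open>L\<^sub>0\<close> at infinity the other lines become points of the affine plane with distinct
  abscissae and distinct ordinates. In the homogeneous coordinates given by the points on \<open>T\<^sub>1\<close> and
  \<open>T\<^sub>2\<close>, every arrow of the groupoid is a scaling, and the group of \<open>L\<^sub>0\<close> is a subgroup \<open>H\<close> of the
  multiplicative group of the field which contains all ratios of slopes of lines joining a point to
  two others; \<open>H\<close> is trivial if the points are collinear. Let \<open>g\<close> be the order of \<open>H\<close>. A point off
  the line \<open>a b\<close> is determined by a pair of distinct elements of \<open>H - {1}\<close>, so there are at most
  \<open>(g - 1) (g - 2)\<close> of them. Applied to \<open>a b\<close> and to \<open>a c\<close> with \<open>c\<close> off \<open>a b\<close>, this bounds
  the number of lines by \<open>2 (g - 1) (g - 2) + 2\<close>. Finally \<open>(g - 1) (g - 2)\<close> is the sum of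
  \<open>n\<^sub>m\<close> over \<open>m dvd g\<close>, because \<open>n\<^sub>m = J\<^sub>2 m - 3 \<phi> m\<close> for \<open>m > 1\<close> with Jordan's totient \<open>J\<^sub>2\<close>.
\<close>

subsection \<open>The integers \<open>n\<^sub>m\<close>\<close>

definition dedekind_psi :: "nat \<Rightarrow> nat" where
  "dedekind_psi n = (\<Prod>q\<in>prime_factors n. q ^ multiplicity q n + q ^ (multiplicity q n - 1))"

lemma dedekind_psi_1 [simp]: "dedekind_psi (Suc 0) = 1"
  by (simp add: dedekind_psi_def)

lemma dedekind_psi_mult_coprime:
  assumes "coprime a b" "a > 0" "b > 0"
  shows "dedekind_psi (a * b) = dedekind_psi a * dedekind_psi b"
proof -
  let ?f = "\<lambda>n q. q ^ multiplicity q n + q ^ (multiplicity q n - 1)"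
  have disj: "prime_factors a \<inter> prime_factors b = {}"
    using coprime_common_divisor_nat[OF assms(1)]
    by (metis One_nat_def disjoint_iff in_prime_factors_imp_dvd in_prime_factors_imp_prime not_prime_1)
  have left: "?f (a * b) q = ?f a q" if "q \<in> prime_factors a" for q
  proof -
    have "\<not> q dvd b" "prime q"
      using that disj assms by (auto simp: prime_factors_dvd)
    then show ?thesis
      using assms by (simp add: prime_elem_multiplicity_mult_distrib not_dvd_imp_multiplicity_0)
  qed
  have right: "?f (a * b) q = ?f b q" if "q \<in> prime_factors b" for q
  proof -
    have "\<not> q dvd a" "prime q"
      using that disj assms by (auto simp: prime_factors_dvd)
    then show ?thesis
      using assms by (simp add: prime_elem_multiplicity_mult_distrib not_dvd_imp_multiplicity_0)
  qed
  have "dedekind_psi (a * b) = (\<Prod>q\<in>prime_factors a \<union> prime_factors b. ?f (a * b) q)"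
    using assms by (simp add: dedekind_psi_def prime_factors_product)
  also have "\<dots> = (\<Prod>q\<in>prime_factors a. ?f (a * b) q) * (\<Prod>q\<in>prime_factors b. ?f (a * b) q)"
    by (rule prod.union_disjoint) (use disj in auto)
  also have "\<dots> = dedekind_psi a * dedekind_psi b"
    unfolding dedekind_psi_def
    by (intro arg_cong2[of _ _ _ _ "(*)"] prod.cong refl left right)
  finally show ?thesis .
qed

lemma dedekind_psi_prime_power:
  assumes "prime p"
  shows "dedekind_psi (p ^ Suc k) = p ^ Suc k + p ^ k"
  using assms by (simp add: dedekind_psi_def prime_factors_power prime_prime_factors
      prime_elem_multiplicity_power_distrib del: power_Suc)

text \<open>Every divisor of \<open>a * b\<close> is \<open>c * d\<close> for exactly one
  \<open>c dvd a\<close> and one \<open>d dvd b\<close>, so the sum factors. This reduces the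
  divisor sum of Jordan's totient to prime powers.\<close>

lemma sum_divisors_mult_coprime:
  fixes f :: "nat \<Rightarrow> 'b::comm_semiring_0"
  assumes f: "\<And>c d. coprime c d \<Longrightarrow> c > 0 \<Longrightarrow> d > 0 \<Longrightarrow> f (c * d) = f c * f d"
    and ab: "coprime a b" "a > 0" "b > 0"
  shows "(\<Sum>d | d dvd a * b. f d) = (\<Sum>d | d dvd a. f d) * (\<Sum>d | d dvd b. f d)"
proof -
  have cop: "coprime c d" if "c dvd a" "d dvd b" for c d
    using ab that by (meson coprime_divisors)
  have inj: "inj_on (\<lambda>(c, d). c * d) ({d. d dvd a} \<times> {d. d dvd b})"
  proof (rule inj_onI, clarsimp)
    fix c d c' d' assume *: "c dvd a" "d dvd b" "c' dvd a" "d' dvd b" "c * d = c' * d'"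
    have "c dvd c' * d'"
      using *(5) by (metis dvd_triv_left)
    moreover have "c' dvd c * d"
      using *(5) by (metis dvd_triv_left)
    ultimately have "c dvd c'" "c' dvd c"
      using cop[OF *(1,4)] cop[OF *(3,2)] by (simp_all add: coprime_dvd_mult_left_iff)
    then have "c = c'"
      by (simp add: dvd_antisym)
    moreover have "c > 0"
      using dvd_pos_nat[OF ab(2) *(1)] .
    ultimately show "c = c' \<and> d = d'"
      using *(5) by simp
  qed
  have img: "{d. d dvd a * b} = (\<lambda>(c, d). c * d) ` ({d. d dvd a} \<times> {d. d dvd b})"
    by (auto simp: image_iff dest: division_decomp intro: mult_dvd_mono)
  have "(\<Sum>d | d dvd a * b. f d) = (\<Sum>(c, d)\<in>{d. d dvd a} \<times> {d. d dvd b}. f (c * d))"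
    unfolding img by (subst sum.reindex[OF inj]) (simp add: case_prod_unfold)
  also have "\<dots> = (\<Sum>(c, d)\<in>{d. d dvd a} \<times> {d. d dvd b}. f c * f d)"
    using ab by (intro sum.cong refl) (auto intro!: f cop intro: dvd_pos_nat)
  finally show ?thesis
    by (simp add: sum_product sum.cartesian_product)
qed

text \<open>The product of \<open>totient\<close> and \<open>dedekind_psi\<close> is Jordan's totient \<open>J\<^sub>2\<close>.\<close>

lemma sum_divisors_prime_power:
  assumes "prime p"
  shows "(\<Sum>d | d dvd p ^ k. totient d * dedekind_psi d) = (p ^ k)\<^sup>2"
proof (induction k)
  case (Suc k)
  have eq: "{d. d dvd p ^ Suc k} = insert (p ^ Suc k) {d. d dvd p ^ k}"
    using assms by (auto simp: divides_primepow_nat le_Suc_eq simp del: power_Suc)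
  have notin: "p ^ Suc k \<notin> {d. d dvd p ^ k}"
    using assms prime_gt_1_nat[OF assms] power_dvd_imp_le[of p "Suc k" k] by auto
  have fin: "finite {d. d dvd p ^ k}"
    using assms by (intro finite_divisors_nat) (simp add: prime_gt_0_nat)
  \<comment> \<open>Writing \<open>p\<close> as a successor removes the truncated
    \<open>p - 1\<close> of the totient formula.\<close>
  obtain c where c: "p = Suc c"
    using prime_gt_0_nat[OF assms] gr0_implies_Suc by blast
  \<comment> \<open>The new term is a difference of consecutive squares, so the sum
    telescopes.\<close>
  have "totient (p ^ Suc k) * dedekind_psi (p ^ Suc k) + (p ^ k)\<^sup>2 = (p ^ Suc k)\<^sup>2"
    using c unfolding totient_prime_power_Suc[OF assms] dedekind_psi_prime_power[OF assms]
    by (simp add: power2_eq_square algebra_simps)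
  then show ?case
    unfolding eq by (subst sum.insert[OF fin notin]) (simp add: Suc.IH)
qed simp

text \<open>Induction splits off the full power of one prime divisor; the cofactor is coprime to it
  and smaller than \<open>n\<close>.\<close>

lemma sum_totient_dedekind_psi_divisors:
  "n > 0 \<Longrightarrow> (\<Sum>d | d dvd n. totient d * dedekind_psi d) = n\<^sup>2"
proof (induction n rule: less_induct)
  case (less n)
  show ?case
  proof (cases "n = 1")
    case False
    then obtain p where p: "prime p" "p dvd n"
      using prime_factor_nat by blast
    define k where "k = multiplicity p n"
    have "n \<noteq> 0" "\<not> is_unit p"
      using less.prems p(1) by auto
    then obtain a where a: "n = p ^ k * a" "\<not> p dvd a"
      unfolding k_def by (rule multiplicity_decompose')
    have "k > 0"
      using p less.prems by (simp add: k_def prime_multiplicity_gt_zero_iff)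
    then have pk: "p ^ k > 1"
      using prime_gt_1_nat[OF p(1)] by (rule one_less_power[rotated])
    have pos: "a > 0"
      using a(2) by (auto intro: Nat.gr0I)
    have "a < n"
      using n_less_m_mult_n[of a "p ^ k"] pos pk a(1) by simp
    have cop: "coprime (p ^ k) a"
      using p a(2) by (simp add: prime_imp_coprime)
    have "(\<Sum>d | d dvd p ^ k * a. totient d * dedekind_psi d)
        = (\<Sum>d | d dvd p ^ k. totient d * dedekind_psi d) * (\<Sum>d | d dvd a. totient d * dedekind_psi d)"
      by (rule sum_divisors_mult_coprime)
        (use cop pos prime_gt_0_nat[OF p(1)] in
          \<open>simp_all add: totient_mult_coprime dedekind_psi_mult_coprime\<close>)
    also have "\<dots> = (p ^ k * a)\<^sup>2"
      using less.IH[OF \<open>a < n\<close> pos] sum_divisors_prime_power[OF p(1)]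
      by (simp add: power_mult_distrib)
    finally show ?thesis
      using a(1) by simp
  qed simp
qed

text \<open>Expanding a product of two-term sums over the prime factors gives a sum over subsets
  \<open>S\<close>. Once the empty and the full subset are put back, the sum in
  \<open>num_lines\<close> is thus a difference of two products, namely
  \<open>dedekind_psi m\<close> and \<open>m\<close>.\<close>

lemma num_lines_eq:
  assumes "m > 1" "\<not> (p > 0 \<and> p dvd m)"
  shows "num_lines p m = int (totient m) * (int (dedekind_psi m) - 3)"
proof -
  define P where "P = prime_factors m"
  define e where "e = (\<lambda>q. multiplicity q m)"
  define F where "F = (\<lambda>S. (\<Prod>q\<in>S. int (q ^ (e q - 1)))
             * ((\<Prod>q \<in> P - S. int (q ^ e q)) - (\<Prod>q \<in> P - S. int (totient (q ^ e q)))))"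
  have finP: "finite P" and Pne: "P \<noteq> {}"
    using assms prime_factorization_empty_iff[of m] by (auto simp: P_def)
  have prime: "prime q" if "q \<in> P" for q
    using that by (auto simp: P_def)
  have e: "e q > 0" if "q \<in> P" for q
    using that by (simp add: e_def P_def prime_factors_multiplicity)
  have m: "(\<Prod>q\<in>P. int (q ^ e q)) = int m"
    using arg_cong[OF prime_factorization_nat[of m], of int] assms unfolding P_def e_def by simp
  have tot: "(\<Prod>q\<in>P. int (totient (q ^ e q))) = int (totient m)"
  proof -
    have "totient m = (\<Prod>q\<in>P. totient (q ^ e q))"
      unfolding P_def e_def totient_formula1[OF order.strict_trans[OF zero_less_one assms(1)]]
      by (intro prod.cong refl totient_prime_power[symmetric]) (auto simp: prime_factors_multiplicity)
    then show ?thesis by simp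
  qed
  have sumF: "sum F (Pow P) = int (dedekind_psi m) - int m"
  proof -
    have "sum F (Pow P) = (\<Sum>S\<in>Pow P. (\<Prod>q\<in>S. int (q ^ (e q - 1))) * (\<Prod>q \<in> P - S. int (q ^ e q)))
       - (\<Sum>S\<in>Pow P. (\<Prod>q\<in>S. int (q ^ (e q - 1))) * (\<Prod>q \<in> P - S. int (totient (q ^ e q))))"
      by (simp add: F_def right_diff_distrib sum_subtractf)
    also have "\<dots> = (\<Prod>q\<in>P. int (q ^ (e q - 1)) + int (q ^ e q))
       - (\<Prod>q\<in>P. int (q ^ (e q - 1)) + int (totient (q ^ e q)))"
      using finP by (simp add: prod_add)
    \<comment> \<open>Since \<open>totient (q ^ e q) = q ^ e q - q ^ (e q - 1)\<close>, this product
      collapses to \<open>m\<close>.\<close>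
    also have "(\<Prod>q\<in>P. int (q ^ (e q - 1)) + int (totient (q ^ e q))) = (\<Prod>q\<in>P. int (q ^ e q))"
    proof (rule prod.cong[OF refl])
      fix q assume q: "q \<in> P"
      have "q ^ (e q - 1) + totient (q ^ e q) = q ^ (e q - 1) * (1 + (q - 1))"
        using e[OF q] prime[OF q] by (simp add: totient_prime_power algebra_simps)
      also have "\<dots> = q ^ e q"
        using e[OF q] prime_gt_0_nat[OF prime[OF q]]
        by (metis One_nat_def Suc_pred plus_1_eq_Suc power_Suc2)
      finally show "int (q ^ (e q - 1)) + int (totient (q ^ e q)) = int (q ^ e q)"
        by (metis of_nat_add)
    qed
    finally show ?thesis
      using m by (simp add: dedekind_psi_def P_def e_def add.commute)
  qed
  \<comment> \<open>The two subsets excluded in \<open>num_lines\<close>; for \<open>S = P\<close>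
    both inner products are empty and cancel.\<close>
  have Feq: "F {} = int m - int (totient m)" "F P = 0"
    using m tot by (simp_all add: F_def)
  let ?S = "{S. S \<noteq> {} \<and> S \<subset> P}"
  have finS: "finite ?S"
    using finP by (auto intro: finite_subset[of _ "Pow P"])
  have "Pow P = insert {} (insert P ?S)"
    by auto
  then have "sum F (Pow P) = sum F (insert {} (insert P ?S))"
    by (rule arg_cong)
  also have "\<dots> = F {} + (F P + sum F ?S)"
    using finS Pne by simp
  finally have "sum F (Pow P) = F {} + (F P + sum F ?S)" .
  then have sum: "sum F ?S = int (dedekind_psi m) - 2 * int m + int (totient m)"
    using Feq sumF by simp
  have "num_lines p m = int (totient m) * (int (totient m) - 1)
      + 2 * int (totient m) * (int m - 1 - int (totient m))
      + int (totient m) * sum F ?S"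
    using assms unfolding num_lines_def F_def P_def e_def Let_def by auto
  then show ?thesis
    unfolding sum by (simp add: algebra_simps)
qed

text \<open>One prime \<open>p\<close> contributes at least \<open>p + 1\<close>, hence at least 3,
  and the other factors are positive. This makes the closed form of \<open>num_lines\<close>
  nonnegative.\<close>

lemma dedekind_psi_ge:
  assumes "n > 1"
  shows "dedekind_psi n \<ge> 3"
proof -
  let ?f = "\<lambda>q. q ^ multiplicity q n + q ^ (multiplicity q n - 1)"
  obtain p where p: "p \<in> prime_factors n"
    using assms prime_factor_nat[of n] by (auto simp: prime_factors_dvd)
  have pos: "prod ?f (prime_factors n - {p}) > 0"
    by (intro prod_pos) (auto simp: prime_gt_0_nat)
  have p2: "p \<ge> 2"
    using p by (auto intro: prime_ge_2_nat)
  have "p ^ multiplicity p n \<ge> p"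
    using p p2 by (intro self_le_power) (auto simp: prime_factors_multiplicity)
  moreover have "p ^ (multiplicity p n - 1) \<ge> 1"
    using p2 by simp
  ultimately have "?f p \<ge> 3"
    using p2 by linarith
  moreover have "prod ?f (prime_factors n - {p}) \<ge> 1"
    using pos by linarith
  ultimately have "3 * 1 \<le> ?f p * prod ?f (prime_factors n - {p})"
    by (rule mult_le_mono)
  also have "\<dots> = dedekind_psi n"
    unfolding dedekind_psi_def using p by (simp add: prod.remove)
  finally show ?thesis by simp
qed

text \<open>Allows the sum over the divisors of the group order to be enlarged to a sum over all
  \<open>m\<close> up to \<open>r\<close>.\<close>

lemma num_lines_nonneg: "num_lines p m \<ge> 0"
proof (cases "m \<le> 1 \<or> (p > 0 \<and> p dvd m)")
  case False
  then show ?thesis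
    using num_lines_eq[of m p] dedekind_psi_ge[of m] by simp
qed (simp add: num_lines_def)

text \<open>The left-hand side counts the pairs of distinct non-identity elements of a cyclic group
  of order \<open>g\<close> by the order of the subgroup that they generate.\<close>

lemma sum_num_lines_divisors:
  assumes "g > 0" "\<not> (p > 0 \<and> p dvd g)"
  shows "(\<Sum>d | d dvd g. num_lines p d) = (int g - 1) * (int g - 2)"
proof -
  let ?D = "{d. d dvd g}"
  have fin: "finite ?D"
    using assms by (simp add: finite_divisors_nat)
  have one: "1 \<in> ?D" by simp
  have "(\<Sum>d\<in>?D - {1}. num_lines p d)
      = (\<Sum>d\<in>?D - {1}. int (totient d * dedekind_psi d) - 3 * int (totient d))"
  proof (rule sum.cong[OF refl])
    fix d assume d: "d \<in> ?D - {1}"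
    then have "d dvd g" "d \<noteq> 1"
      by auto
    then have "d > 1"
      using dvd_pos_nat[OF assms(1) \<open>d dvd g\<close>] by (simp add: nat_neq_iff)
    moreover have "\<not> (p > 0 \<and> p dvd d)"
      using assms(2) \<open>d dvd g\<close> by (meson dvd_trans)
    ultimately show "num_lines p d = int (totient d * dedekind_psi d) - 3 * int (totient d)"
      by (simp add: num_lines_eq algebra_simps)
  qed
  \<comment> \<open>The summand at \<open>d = 1\<close> would be \<open>1 - 3 = -2\<close>;
    including it is offset by \<open>+ 2\<close>.\<close>
  also have "\<dots> = (\<Sum>d\<in>?D. int (totient d * dedekind_psi d) - 3 * int (totient d)) + 2"
    using fin by (subst sum.remove[OF fin one]) simp
  also have "\<dots> = int (\<Sum>d\<in>?D. totient d * dedekind_psi d) - 3 * int (\<Sum>d\<in>?D. totient d) + 2"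
    by (simp add: sum_subtractf sum_distrib_left)
  also have "\<dots> = (int g - 1) * (int g - 2)"
    unfolding sum_totient_dedekind_psi_divisors[OF assms(1)] totient_divisor_sum
    by (simp add: power2_eq_square algebra_simps)
  finally show ?thesis
    by (subst sum.remove[OF fin one]) (simp add: num_lines_def)
qed

subsection \<open>Slopes and finite multiplicative groups\<close>

definition slope :: "('i \<Rightarrow> 'a::field) \<Rightarrow> ('i \<Rightarrow> 'a) \<Rightarrow> 'i \<Rightarrow> 'i \<Rightarrow> 'a" where
  "slope x y p q = (y p - y q) / (x p - x q)"

lemma slope_commute: "slope x y p q = slope x y q p"
  unfolding slope_def by (metis minus_diff_eq minus_divide_divide)

lemma slope_eq_iff: "x p \<noteq> x q \<Longrightarrow> slope x y p q = m \<longleftrightarrow> y p - y q = m * (x p - x q)"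
  by (simp add: slope_def nonzero_divide_eq_eq)

lemma slope_eq_0_iff: "slope x y p q = 0 \<longleftrightarrow> x p = x q \<or> y p = y q"
  by (auto simp: slope_def)

lemma slope_eq_trans:
  assumes "x p \<noteq> x q" "x p \<noteq> x r" "x q \<noteq> x r" "slope x y p q = m" "slope x y q r = m"
  shows "slope x y p r = m"
proof -
  have "y p - y r = (y p - y q) + (y q - y r)"
    by simp
  also have "\<dots> = m * (x p - x q) + m * (x q - x r)"
    using assms by (simp add: slope_eq_iff)
  also have "\<dots> = m * (x p - x r)"
    by (simp add: algebra_simps)
  finally show ?thesis
    using assms by (simp add: slope_eq_iff)
qed

text \<open>A point off the line \<open>a b\<close> is the intersection of the lines through \<open>a\<close> and \<open>b\<close> with given
  slopes, so it is determined by the ratios of these slopes to that of \<open>a b\<close>.\<close>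

lemma card_off_line_le:
  fixes x y :: "'i \<Rightarrow> 'a::field"
  assumes x: "inj_on x P" and y: "inj_on y P" and finH: "finite H" and one: "1 \<in> H"
    and ratio: "\<And>p q r. \<lbrakk>p \<in> P; q \<in> P; r \<in> P; p \<noteq> q; p \<noteq> r; q \<noteq> r\<rbrakk>
      \<Longrightarrow> slope x y p q / slope x y p r \<in> H"
    and a: "a \<in> P" and b: "b \<in> P" and ab: "a \<noteq> b"
  shows "card {q \<in> P - {a, b}. slope x y a q \<noteq> slope x y a b} \<le> (card H - 1) * (card H - 2)"
proof -
  let ?s = "slope x y"
  let ?N = "{q \<in> P - {a, b}. ?s a q \<noteq> ?s a b}"
  let ?f = "\<lambda>q. (?s a q / ?s a b, ?s b q / ?s a b)"
  let ?S = "Sigma (H - {1}) (\<lambda>s. H - {1, s})"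
  have xne: "x p \<noteq> x q" if "p \<in> P" "q \<in> P" "p \<noteq> q" for p q
    using x that by (auto dest: inj_onD)
  have nz: "?s p q \<noteq> 0" if "p \<in> P" "q \<in> P" "p \<noteq> q" for p q
    using x y that by (auto simp: slope_eq_0_iff dest: inj_onD)
  \<comment> \<open>Either equality would put \<open>q\<close> on the line
    \<open>a b\<close>.\<close>
  have diff: "?s b q \<noteq> ?s a b" "?s b q \<noteq> ?s a q" if q: "q \<in> ?N" for q
  proof -
    have ne: "x a \<noteq> x b" "x b \<noteq> x q" "x a \<noteq> x q"
      using xne q a b ab by auto
    show "?s b q \<noteq> ?s a b"
      using slope_eq_trans[of x a b q y "?s a b"] ne q by auto
    show "?s b q \<noteq> ?s a q"
      using slope_eq_trans[of x a q b y "?s a q"] ne q by (auto simp: slope_commute)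
  qed
  have "?f ` ?N \<subseteq> ?S"
  proof
    fix z assume "z \<in> ?f ` ?N"
    then obtain q where q: "q \<in> ?N" "z = ?f q" by blast
    have "?s a q / ?s a b \<in> H"
      using q a b ab by (intro ratio) auto
    \<comment> \<open>Ratios in \<open>H\<close> share their first point, so the slope from
      \<open>b\<close> is divided by that of \<open>b a\<close>; by symmetry this is the slope of
      \<open>a b\<close>.\<close>
    moreover have "?s b q / ?s b a \<in> H"
      using q a b ab by (intro ratio) auto
    ultimately show "z \<in> ?S"
      using q diff[OF q(1)] nz[OF a b ab] by (auto simp: slope_commute[of x y b a])
  qed
  moreover have "inj_on ?f ?N"
  proof (rule inj_onI)
    fix q r assume q: "q \<in> ?N" and r: "r \<in> ?N" and eq: "?f q = ?f r"
    define m n where "m = ?s a q" "n = ?s b q"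
    have mn: "?s a r = m" "?s b r = n"
      using eq nz[OF a b ab] by (auto simp: m_n_def)
    \<comment> \<open>Eliminating \<open>y t\<close> from the equations of the line through
      \<open>a\<close> with slope \<open>m\<close> and the line through \<open>b\<close> with slope
      \<open>n\<close> leaves a linear equation for \<open>x t\<close>, uniquely solvable because
      the slopes differ.\<close>
    have *: "(m - n) * x t = y b - y a + m * x a - n * x b" if "t \<in> {q, r}" for t
    proof -
      have "x a \<noteq> x t" "x b \<noteq> x t"
        using xne[OF a, of t] xne[OF b, of t] that q r by auto
      moreover have "?s a t = m" "?s b t = n"
        using that mn by (auto simp: m_n_def)
      ultimately have "y a - y t = m * (x a - x t)" "y b - y t = n * (x b - x t)"
        by (simp_all add: slope_eq_iff)
      then show ?thesis
        by algebra
    qed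
    have "m - n \<noteq> 0"
      using diff(2)[OF q] by (auto simp: m_n_def)
    then have "x q = x r"
      using *[of q] *[of r] by (metis insertCI mult_cancel_left)
    then show "q = r"
      using xne[of q r] q r by auto
  qed
  moreover have "finite ?S"
    using finH by simp
  ultimately have "card ?N \<le> card ?S"
    using card_mono[of ?S "?f ` ?N"] by (simp only: card_image)
  also have "card ?S = (\<Sum>s\<in>H - {1}. card (H - {1, s}))"
    using finH by (intro card_SigmaI) auto
  also have "\<dots> = (\<Sum>s\<in>H - {1}. card H - 2)"
  proof (rule sum.cong[OF refl])
    fix s assume "s \<in> H - {1}"
    then show "card (H - {1, s}) = card H - 2"
      using finH one by (subst card_Diff_subset) auto
  qed
  also have "\<dots> = (card H - 1) * (card H - 2)"
    using finH one by simp
  finally show ?thesis .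
qed

text \<open>The points on the line \<open>a b\<close> other than \<open>a\<close> lie off the line \<open>a c\<close>.\<close>

lemma card_noncollinear_le:
  fixes x y :: "'i \<Rightarrow> 'a::field"
  assumes fin: "finite P" and x: "inj_on x P" and y: "inj_on y P" and finH: "finite H" and one: "1 \<in> H"
    and ratio: "\<And>p q r. \<lbrakk>p \<in> P; q \<in> P; r \<in> P; p \<noteq> q; p \<noteq> r; q \<noteq> r\<rbrakk>
      \<Longrightarrow> slope x y p q / slope x y p r \<in> H"
    and P: "a \<in> P" "b \<in> P" "c \<in> P" "a \<noteq> b" "a \<noteq> c" "slope x y a c \<noteq> slope x y a b"
  shows "card P \<le> 2 * ((card H - 1) * (card H - 2)) + 1"
proof -
  let ?N = "\<lambda>b. {q \<in> P - {a, b}. slope x y a q \<noteq> slope x y a b}"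
  \<comment> \<open>The points \<open>b\<close> and \<open>c\<close>, removed from one set each, lie
    in the other.\<close>
  have "P \<subseteq> insert a (?N b \<union> ?N c)"
    using P by auto
  then have "card P \<le> card (insert a (?N b \<union> ?N c))"
    using fin by (intro card_mono) auto
  also have "\<dots> \<le> Suc (card (?N b \<union> ?N c))"
    by (rule card_insert_le_m1) auto
  also have "card (?N b \<union> ?N c) \<le> card (?N b) + card (?N c)"
    by (rule card_Un_le)
  also have "card (?N b) \<le> (card H - 1) * (card H - 2)"
    by (rule card_off_line_le[OF x y finH one ratio]) (use P in auto)
  also have "card (?N c) \<le> (card H - 1) * (card H - 2)"
    by (rule card_off_line_le[OF x y finH one ratio]) (use P in auto)
  finally show ?thesis by simp
qed

section \<open>The order of a finite multiplicative group and the characteristic\<close>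

lemma power_prime_CHAR_eq_1:
  fixes y :: "'a::idom"
  assumes p: "prime CHAR('a)" and y: "y ^ CHAR('a) = 1"
  shows "y = 1"
proof -
  let ?p = "CHAR('a)"
  have "y ^ ?p = ((y - 1) + 1) ^ ?p"
    by simp
  \<comment> \<open>Frobenius: the characteristic divides all inner binomial coefficients, so
    \<open>y ^ ?p - 1 = (y - 1) ^ ?p\<close>, which vanishes only at 1.\<close>
  also have "\<dots> = (\<Sum>k\<le>?p. of_nat (?p choose k) * (y - 1) ^ k)"
    by (subst binomial_ring) simp
  also have "\<dots> = (\<Sum>k\<in>{0, ?p}. of_nat (?p choose k) * (y - 1) ^ k)"
  proof (rule sum.mono_neutral_right)
    show "\<forall>k\<in>{..?p} - {0, ?p}. of_nat (?p choose k) * (y - 1) ^ k = 0"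
      using p by (auto simp: of_nat_eq_0_iff_char_dvd intro!: dvd_choose_prime)
  qed auto
  also have "\<dots> = 1 + (y - 1) ^ ?p"
    using prime_gt_0_nat[OF p] by (subst sum.insert) auto
  finally show ?thesis
    using y by simp
qed

text \<open>If the order were \<open>p * k\<close> with \<open>p\<close> the characteristic, the
  power \<open>p * k\<close> of each element would be 1, and by Frobenius already the power
  \<open>k\<close>. Then \<open>X ^ k - 1\<close> would have more than \<open>k\<close> roots. The
  divisor sum of the \<open>num_lines\<close> relies on this, as they vanish at multiples of the
  characteristic.\<close>

lemma not_CHAR_dvd_card:
  fixes H :: "'a::field set"
  assumes fin: "finite H" and zero: "0 \<notin> H" and one: "1 \<in> H"
    and mult: "\<And>s t. s \<in> H \<Longrightarrow> t \<in> H \<Longrightarrow> s * t \<in> H"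
  shows "\<not> (CHAR('a) > 0 \<and> CHAR('a) dvd card H)"
proof
  assume *: "CHAR('a) > 0 \<and> CHAR('a) dvd card H"
  then obtain k where k: "card H = CHAR('a) * k"
    by blast
  have p: "prime CHAR('a)"
    using * by (simp add: prime_CHAR_semidom)
  have "card H > 0"
    using fin one by (auto simp: card_gt_0_iff)
  then have "k > 0"
    using k by (auto intro: Nat.gr0I)
  have root: "s ^ k = 1" if s: "s \<in> H" for s
  proof -
    have "s \<noteq> 0"
      using s zero by auto
    then have inj: "inj_on ((*) s) H"
      by (auto simp: inj_on_def)
    then have img: "(*) s ` H = H"
      using fin mult s by (intro endo_inj_surj) auto
    \<comment> \<open>Multiplication by \<open>s\<close> permutes \<open>H\<close>, and the nonzero
      product of \<open>H\<close> cancels.\<close>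
    have "\<Prod>H = (\<Prod>h\<in>H. s * h)"
      using prod.reindex[OF inj, of id] img by simp
    also have "\<dots> = s ^ card H * \<Prod>H"
      by (simp add: prod.distrib)
    finally have "s ^ card H = 1"
      using fin zero by (auto simp: prod_zero_iff)
    then have "(s ^ k) ^ CHAR('a) = 1"
      unfolding k by (simp add: power_mult[symmetric] mult.commute)
    then show ?thesis
      using p power_prime_CHAR_eq_1 by blast
  qed
  let ?f = "monom 1 k - 1 :: 'a poly"
  have deg: "degree ?f \<le> k"
    by (intro degree_diff_le degree_monom_le) auto
  have "coeff ?f k = 1"
    using \<open>k > 0\<close> by simp
  then have "?f \<noteq> 0"
    by (metis coeff_0 zero_neq_one)
  then have "card H \<le> card {s. poly ?f s = 0}"
    using root by (intro card_mono poly_roots_finite) (auto simp: poly_monom)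
  also have "\<dots> \<le> k"
    using card_poly_roots_bound[OF \<open>?f \<noteq> 0\<close>] deg by simp
  finally show False
    using k \<open>k > 0\<close> prime_gt_1_nat[OF p] by simp
qed

subsection \<open>Skew lines with two transversals\<close>

text \<open>Independence of a pair rather than of the set \<open>{u, v}\<close>: it fails for
  \<open>u = v\<close>.\<close>

definition indep_pair :: "'a::field ^ 'n \<Rightarrow> 'a ^ 'n \<Rightarrow> bool" where
  "indep_pair u v \<longleftrightarrow> (\<forall>a b. a *s u + b *s v = 0 \<longrightarrow> a = 0 \<and> b = 0)"

section \<open>Spans, points and lines as subspaces\<close>

lemma mem_span_single: "z \<in> vec.span {w} \<longleftrightarrow> (\<exists>a. z = a *s w)"
  by (auto simp: vec.span_singleton)

lemma mem_span_pair: "z \<in> vec.span {u, v} \<longleftrightarrow> (\<exists>a b. z = a *s u + b *s v)"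
proof
  assume "z \<in> vec.span {u, v}"
  then obtain a where "z - a *s u \<in> vec.span {v}"
    by (auto simp: vec.span_breakdown_eq)
  then obtain b where "z - a *s u = b *s v"
    by (auto simp: mem_span_single)
  then have "z = a *s u + b *s v"
    by (simp add: algebra_simps)
  then show "\<exists>a b. z = a *s u + b *s v" by blast
next
  assume "\<exists>a b. z = a *s u + b *s v"
  then show "z \<in> vec.span {u, v}"
    by (auto intro!: vec.span_add vec.span_scale intro: vec.span_base)
qed

lemma span_single_scale: "c \<noteq> 0 \<Longrightarrow> vec.span {c *s w} = vec.span {w}"
  for w :: "'a::field ^ 'n"
  by (rule vec.span_eq[THEN iffD2])
    (auto simp: mem_span_single intro: exI[of _ "1 / c"])

lemma indep_pair_imp_independent:
  assumes "indep_pair u v"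
  shows "vec.independent {u, v}" "u \<noteq> v"
proof -
  have v: "v \<noteq> 0"
    using assms[unfolded indep_pair_def, rule_format, of 0 1] by auto
  have "u \<noteq> b *s v" for b
    using assms[unfolded indep_pair_def, rule_format, of 1 "- b"] by auto
  then have "u \<notin> vec.span {v}"
    by (simp add: mem_span_single)
  then show "vec.independent {u, v}"
    using v vec.independent_empty by (intro vec.independent_insertI) auto
  show "u \<noteq> v"
    using \<open>u \<notin> vec.span {v}\<close> vec.span_base[of v "{v}"] by auto
qed

lemma proj_line_eq_span:
  assumes T: "proj_line T" and uv: "u \<in> T" "v \<in> T" "indep_pair u v"
  shows "T = vec.span {u, v}"
proof
  show "vec.span {u, v} \<subseteq> T"
    using assms by (intro vec.span_minimal) (auto simp: proj_line_def)
  show "T \<subseteq> vec.span {u, v}"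
    by (rule vec.card_ge_dim_independent)
      (use assms indep_pair_imp_independent[OF uv(3)] in \<open>auto simp: proj_line_def\<close>)
qed

lemma proj_point_iff: "proj_point P \<longleftrightarrow> (\<exists>w. w \<noteq> 0 \<and> P = vec.span {w})"
proof
  assume P: "proj_point P"
  obtain B where B: "B \<subseteq> P" "vec.independent B" "P \<subseteq> vec.span B" "card B = vec.dim P"
    by (rule vec.basis_exists)
  then obtain w where w: "B = {w}"
    using P by (auto simp: proj_point_def card_1_singleton_iff)
  then have "P = vec.span {w}"
    using B P by (auto simp: proj_point_def intro: vec.span_minimal[THEN subsetD])
  moreover have "w \<noteq> 0"
    using B(2) w by auto
  ultimately show "\<exists>w. w \<noteq> 0 \<and> P = vec.span {w}" by blast
next
  assume "\<exists>w. w \<noteq> 0 \<and> P = vec.span {w}"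
  then show "proj_point P"
    by (auto simp: proj_point_def vec.dim_span vec.dim_eq_card_independent)
qed

lemma lines_meet_iff:
  assumes "proj_line L" "proj_line M"
  shows "lines_meet L M \<longleftrightarrow> (\<exists>w. w \<noteq> 0 \<and> w \<in> L \<and> w \<in> M)"
proof -
  have sub: "vec.span {w} \<subseteq> L \<longleftrightarrow> w \<in> L" if "proj_line L" for w and L :: "('a ^ 4) set"
    using that vec.span_base[of w "{w}"] vec.span_minimal[of "{w}" L]
    by (auto simp: proj_line_def)
  show ?thesis
    using sub[OF assms(1)] sub[OF assms(2)]
    unfolding lines_meet_def points_on_def proj_point_iff by blast
qed

lemma skew_lines_Int:
  assumes "skew_lines \<L>" "L \<in> \<L>" "M \<in> \<L>" "L \<noteq> M"
  shows "L \<inter> M = {0}"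
proof -
  have "proj_line L" "proj_line M" "\<not> lines_meet L M"
    using assms by (auto simp: skew_lines_def pairwise_def)
  then show ?thesis
    using lines_meet_iff[of L M] vec.subspace_0 by (auto simp: proj_line_def)
qed

lemma transversal_point:
  assumes "skew_lines \<L>" "is_transversal \<L> T" "L \<in> \<L>"
  obtains w where "w \<noteq> 0" "w \<in> T" "w \<in> L"
  using assms lines_meet_iff[of T L] by (auto simp: skew_lines_def is_transversal_def)

lemma proj_line_lincomb:
  assumes "proj_line L" "z \<in> L" "w \<in> L"
  shows "a *s z + b *s w \<in> L"
  using assms by (auto simp: proj_line_def intro!: vec.subspace_add vec.subspace_scale)

lemma proj_line_scale_iff:
  assumes "proj_line L" "a \<noteq> 0"
  shows "a *s z \<in> L \<longleftrightarrow> z \<in> L"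
proof
  assume "a *s z \<in> L"
  then have "(1 / a) *s (a *s z) \<in> L"
    using assms(1) by (auto simp only: proj_line_def intro!: vec.subspace_scale)
  then show "z \<in> L"
    using assms(2) by simp
qed (use assms in \<open>auto simp: proj_line_def intro!: vec.subspace_scale\<close>)

lemma indep_pair_of_not_mem:
  assumes L: "proj_line L" and w: "w \<notin> L" and z: "z \<in> L" "z \<noteq> 0"
  shows "indep_pair w z"
  unfolding indep_pair_def
proof (intro allI impI)
  fix a b assume 0: "a *s w + b *s z = 0"
  then have "a *s w = (- b) *s z + 0 *s z"
    by (simp add: eq_neg_iff_add_eq_0)
  then have "a *s w \<in> L"
    using proj_line_lincomb[OF L z(1) z(1)] by metis
  then have "a = 0"
    using proj_line_scale_iff[OF L] w by blast
  then show "a = 0 \<and> b = 0"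
    using 0 z(2) by simp
qed

text \<open>Through a common point of \<open>T\<^sub>1\<close> and \<open>T\<^sub>2\<close> there passes at most one line of \<open>\<L>\<close>; any two
  other lines of \<open>\<L>\<close> would lie in the plane of \<open>T\<^sub>1\<close> and \<open>T\<^sub>2\<close>, hence would meet.\<close>

lemma transversals_Int:
  fixes \<L> :: "('a::field ^ 4) set set"
  assumes fin: "finite \<L>" and card: "card \<L> \<ge> 3" and skew: "skew_lines \<L>"
    and T: "is_transversal \<L> T\<^sub>1" "is_transversal \<L> T\<^sub>2" "T\<^sub>1 \<noteq> T\<^sub>2"
  shows "T\<^sub>1 \<inter> T\<^sub>2 = {0}"
proof -
  have line: "proj_line T\<^sub>1" "proj_line T\<^sub>2" "\<And>L. L \<in> \<L> \<Longrightarrow> proj_line L"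
    using T skew by (auto simp: is_transversal_def skew_lines_def)
  have False if w: "w \<noteq> 0" "w \<in> T\<^sub>1" "w \<in> T\<^sub>2" for w
  proof -
    \<comment> \<open>Skewness allows at most one line through \<open>w\<close>, so at least two of
      the lines avoid it.\<close>
    have "card {L \<in> \<L>. w \<in> L} \<le> 1"
      using skew_lines_Int[OF skew] w(1) fin
      by (subst card_le_Suc0_iff_eq[unfolded One_nat_def[symmetric]]) auto
    moreover have "card \<L> = card {L \<in> \<L>. w \<in> L} + card {L \<in> \<L>. w \<notin> L}"
      using fin by (subst card_Un_disjoint[symmetric]) (auto intro!: arg_cong[of _ _ card])
    ultimately have "\<not> card {L \<in> \<L>. w \<notin> L} \<le> 1"
      using card by linarith
    then obtain L M where LM: "L \<in> \<L>" "M \<in> \<L>" "L \<noteq> M" "w \<notin> L" "w \<notin> M"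
      using fin by (subst (asm) card_le_Suc0_iff_eq[unfolded One_nat_def[symmetric]]) auto
    obtain u where u: "u \<noteq> 0" "u \<in> T\<^sub>1" "u \<in> L"
      using transversal_point[OF skew T(1) LM(1)] .
    obtain v where v: "v \<noteq> 0" "v \<in> T\<^sub>2" "v \<in> L"
      using transversal_point[OF skew T(2) LM(1)] .
    obtain u' where u': "u' \<noteq> 0" "u' \<in> T\<^sub>1" "u' \<in> M"
      using transversal_point[OF skew T(1) LM(2)] .
    obtain v' where v': "v' \<noteq> 0" "v' \<in> T\<^sub>2" "v' \<in> M"
      using transversal_point[OF skew T(2) LM(2)] .
    have "T\<^sub>1 = vec.span {w, u}" "T\<^sub>2 = vec.span {w, v}"
      using proj_line_eq_span line LM indep_pair_of_not_mem u v w by metis+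
    then obtain a b c d where ab: "u' = a *s w + b *s u" and cd: "v' = c *s w + d *s v"
      using u'(2) v'(2) mem_span_pair by metis
    have Int: "L \<inter> M = {0}"
      using skew_lines_Int[OF skew LM(1-3)] .
    \<comment> \<open>For \<open>a = 0\<close> the vector \<open>u'\<close> of \<open>M\<close>
      would also lie on \<open>L\<close>; likewise for \<open>c\<close> and
      \<open>v'\<close>.\<close>
    have "a \<noteq> 0"
    proof
      assume "a = 0"
      then have "u' = b *s u + 0 *s u"
        using ab by simp
      then have "u' \<in> L"
        using proj_line_lincomb[OF line(3)[OF LM(1)] u(3) u(3)] by metis
      then show False
        using u' Int by blast
    qed
    have "c \<noteq> 0"
    proof
      assume "c = 0"
      then have "v' = d *s v + 0 *s v"
        using cd by simp
      then have "v' \<in> L"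
        using proj_line_lincomb[OF line(3)[OF LM(1)] v(3) v(3)] by metis
      then show False
        using v' Int by blast
    qed
    \<comment> \<open>The coefficients cancel \<open>w\<close>: the left side lies on
      \<open>M\<close> and the right side on \<open>L\<close>, so both vanish.\<close>
    have "c *s u' + (- a) *s v' = (c * b) *s u + (- (a * d)) *s v"
      unfolding ab cd by (simp add: vec.scale_right_distrib algebra_simps)
    then have "c *s u' + (- a) *s v' \<in> L \<inter> M"
      using proj_line_lincomb[OF line(3)[OF LM(1)] u(3) v(3)]
        proj_line_lincomb[OF line(3)[OF LM(2)] u'(3) v'(3)] by (metis IntI)
    then have "c *s u' = a *s v'"
      unfolding Int by (simp add: eq_neg_iff_add_eq_0)
    \<comment> \<open>Both transversals then contain \<open>w\<close> and \<open>u'\<close>, hence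
      coincide.\<close>
    then have "u' \<in> T\<^sub>2"
      using proj_line_scale_iff[OF line(2)] v'(2) \<open>a \<noteq> 0\<close> \<open>c \<noteq> 0\<close> by metis
    then have "T\<^sub>1 = vec.span {w, u'}" "T\<^sub>2 = vec.span {w, u'}"
      using proj_line_eq_span line LM indep_pair_of_not_mem u' w by metis+
    then show False
      using T(3) by simp
  qed
  then show ?thesis
    using vec.subspace_0 line by (auto simp: proj_line_def)
qed

text \<open>On \<open>T\<close> the point of \<open>L\<^sub>0\<close> is put at infinity and that of
  \<open>L\<^sub>1\<close>, represented by \<open>e\<close>, at the origin. The points of the other
  lines are off \<open>L\<^sub>0\<close>, so their coefficient at \<open>e\<close> is nonzero and
  can be scaled to 1.\<close>

lemma transversal_affine_coordinate:
  fixes \<L> :: "('a::field ^ 4) set set"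
  assumes skew: "skew_lines \<L>" and T: "is_transversal \<L> T"
    and L: "L\<^sub>0 \<in> \<L>" "L\<^sub>1 \<in> \<L>" "L\<^sub>0 \<noteq> L\<^sub>1"
  obtains u x e where "\<And>L. L \<in> \<L> \<Longrightarrow> u L \<in> L \<and> u L \<in> T \<and> u L \<noteq> 0"
    "\<And>L. L \<in> \<L> \<Longrightarrow> L \<noteq> L\<^sub>0 \<Longrightarrow> u L = x L *s u L\<^sub>0 + e"
proof -
  have line: "proj_line T" "\<And>L. L \<in> \<L> \<Longrightarrow> proj_line L"
    using T skew by (auto simp: is_transversal_def skew_lines_def)
  obtain w\<^sub>0 where w\<^sub>0: "w\<^sub>0 \<noteq> 0" "w\<^sub>0 \<in> T" "w\<^sub>0 \<in> L\<^sub>0"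
    using transversal_point[OF skew T L(1)] .
  obtain w\<^sub>1 where w\<^sub>1: "w\<^sub>1 \<noteq> 0" "w\<^sub>1 \<in> T" "w\<^sub>1 \<in> L\<^sub>1"
    using transversal_point[OF skew T L(2)] .
  have "w\<^sub>1 \<notin> L\<^sub>0"
    using skew_lines_Int[OF skew L] w\<^sub>1 by blast
  then have indep: "indep_pair w\<^sub>1 w\<^sub>0"
    using indep_pair_of_not_mem line L w\<^sub>0 by blast
  have "\<exists>x. x *s w\<^sub>0 + w\<^sub>1 \<in> L \<inter> T \<and> x *s w\<^sub>0 + w\<^sub>1 \<noteq> 0" if M: "L \<in> \<L>" "L \<noteq> L\<^sub>0" for L
  proof -
    obtain w where w: "w \<noteq> 0" "w \<in> T" "w \<in> L"
      using transversal_point[OF skew T M(1)] .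
    obtain b a where ab: "w = b *s w\<^sub>1 + a *s w\<^sub>0"
      using w(2) proj_line_eq_span[OF line(1) w\<^sub>1(2) w\<^sub>0(2) indep] mem_span_pair by metis
    have "b \<noteq> 0"
    proof
      assume "b = 0"
      then have "w = a *s w\<^sub>0 + 0 *s w\<^sub>0"
        using ab by simp
      then have "w \<in> L\<^sub>0"
        using proj_line_lincomb[OF line(2)[OF L(1)] w\<^sub>0(3) w\<^sub>0(3)] by metis
      then show False
        using skew_lines_Int[OF skew M(1) L(1) M(2)] w by blast
    qed
    then have "b *s ((a / b) *s w\<^sub>0 + w\<^sub>1) = w"
      unfolding ab by (simp add: vec.scale_right_distrib algebra_simps)
    then have "(a / b) *s w\<^sub>0 + w\<^sub>1 \<in> L" "(a / b) *s w\<^sub>0 + w\<^sub>1 \<in> T" "(a / b) *s w\<^sub>0 + w\<^sub>1 \<noteq> 0"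
      using w proj_line_scale_iff[OF line(2)[OF M(1)] \<open>b \<noteq> 0\<close>] proj_line_scale_iff[OF line(1) \<open>b \<noteq> 0\<close>]
      by auto
    then show ?thesis by blast
  qed
  then obtain x where x: "\<And>L. L \<in> \<L> \<Longrightarrow> L \<noteq> L\<^sub>0 \<Longrightarrow>
      x L *s w\<^sub>0 + w\<^sub>1 \<in> L \<inter> T \<and> x L *s w\<^sub>0 + w\<^sub>1 \<noteq> 0"
    by metis
  show thesis
    by (rule that[of "\<lambda>L. if L = L\<^sub>0 then w\<^sub>0 else x L *s w\<^sub>0 + w\<^sub>1" x w\<^sub>1]) (use x w\<^sub>0 in auto)
qed

text \<open>\<open>L\<^sub>0\<close> is the line at infinity, any other \<open>L\<close> the affine
  point \<open>(x L, y L)\<close>. The vectors \<open>u L\<close> and \<open>v L\<close> stand for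
  the points of \<open>L\<close> on the two transversals, normalised to coefficient 1 at
  \<open>e\<close> and \<open>f\<close>.\<close>

locale two_transversal_coordinates =
  fixes \<L> :: "('a::field ^ 4) set set" and L\<^sub>0 :: "('a ^ 4) set"
    and u v :: "('a ^ 4) set \<Rightarrow> 'a ^ 4" and x y :: "('a ^ 4) set \<Rightarrow> 'a" and e f :: "'a ^ 4"
  assumes base: "L\<^sub>0 \<in> \<L>"
    and indep: "L \<in> \<L> \<Longrightarrow> indep_pair (u L) (v L)"
    and eq_span: "L \<in> \<L> \<Longrightarrow> L = vec.span {u L, v L}"
    and Int_eq: "L \<in> \<L> \<Longrightarrow> M \<in> \<L> \<Longrightarrow> L \<noteq> M \<Longrightarrow> L \<inter> M = {0}"
    and u_eq: "L \<in> \<L> \<Longrightarrow> L \<noteq> L\<^sub>0 \<Longrightarrow> u L = x L *s u L\<^sub>0 + e"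
    and v_eq: "L \<in> \<L> \<Longrightarrow> L \<noteq> L\<^sub>0 \<Longrightarrow> v L = y L *s v L\<^sub>0 + f"
begin

definition pt :: "('a ^ 4) set \<Rightarrow> 'a \<Rightarrow> 'a \<Rightarrow> ('a ^ 4) set" where
  "pt L a b = vec.span {a *s u L + b *s v L}"

text \<open>Every arrow of the groupoid acts as a scaling in the homogeneous coordinates given by the
  points of the lines on the two transversals.\<close>

definition scaling ::
  "('a ^ 4) set \<Rightarrow> ('a ^ 4) set \<Rightarrow> 'a \<Rightarrow> (('a ^ 4) set \<Rightarrow> ('a ^ 4) set) \<Rightarrow> bool" where
  "scaling L M c g \<longleftrightarrow> c \<noteq> 0 \<and> g \<in> extensional (points_on L) \<and>
    (\<forall>a b. (a, b) \<noteq> (0, 0) \<longrightarrow> g (pt L a b) = pt M a (c * b))"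

section \<open>Homogeneous coordinates on a line\<close>

lemma lincomb_eq_0: "L \<in> \<L> \<Longrightarrow> a *s u L + b *s v L = 0 \<Longrightarrow> a = 0 \<and> b = 0"
  using indep[of L] by (auto simp: indep_pair_def)

lemma mem_iff: "L \<in> \<L> \<Longrightarrow> z \<in> L \<longleftrightarrow> (\<exists>a b. z = a *s u L + b *s v L)"
  using eq_span[of L] mem_span_pair[of z "u L" "v L"] by simp

lemma subspace: "L \<in> \<L> \<Longrightarrow> vec.subspace L"
  using eq_span[of L] vec.subspace_span by metis

lemma uv_mem: "L \<in> \<L> \<Longrightarrow> u L \<in> L" "L \<in> \<L> \<Longrightarrow> v L \<in> L"
  using eq_span[of L] vec.span_base[of _ "{u L, v L}"] by blast+

lemma pt_in_points_on:
  assumes L: "L \<in> \<L>" and ab: "(a, b) \<noteq> (0, 0)"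
  shows "pt L a b \<in> points_on L"
proof -
  have "a *s u L + b *s v L \<in> L"
    using L mem_iff by blast
  then have "pt L a b \<subseteq> L"
    unfolding pt_def using subspace[OF L] by (intro vec.span_minimal) auto
  moreover have "a *s u L + b *s v L \<noteq> 0"
    using lincomb_eq_0[OF L] ab by auto
  ultimately show ?thesis
    by (auto simp: points_on_def proj_point_iff pt_def)
qed

lemma points_on_eq_pt:
  assumes L: "L \<in> \<L>" and q: "q \<in> points_on L"
  obtains a b where "(a, b) \<noteq> (0, 0)" "q = pt L a b"
proof -
  obtain w where w: "w \<noteq> 0" "q = vec.span {w}" "q \<subseteq> L"
    using q by (auto simp: points_on_def proj_point_iff)
  then have "w \<in> L"
    using vec.span_base[of w "{w}"] by auto
  then obtain a b where ab: "w = a *s u L + b *s v L"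
    using mem_iff[OF L] by blast
  show thesis
    by (rule that[of a b]) (use w ab in \<open>auto simp: pt_def\<close>)
qed

lemma pt_scale: "c \<noteq> 0 \<Longrightarrow> pt L (c * a) (c * b) = pt L a b"
  using span_single_scale[of c "a *s u L + b *s v L"]
  by (simp add: pt_def vec.scale_right_distrib)

lemma pt_1_eqD:
  assumes L: "L \<in> \<L>" and eq: "pt L 1 c = pt L 1 d"
  shows "c = d"
proof -
  have "1 *s u L + c *s v L \<in> vec.span {1 *s u L + d *s v L}"
    using eq vec.span_base[of "1 *s u L + c *s v L" "{1 *s u L + c *s v L}"]
    by (simp add: pt_def)
  then obtain a where "1 *s u L + c *s v L = a *s (1 *s u L + d *s v L)"
    by (auto simp only: mem_span_single)
  then have "(1 - a) *s u L + (c - a * d) *s v L = 0"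
    by (simp add: algebra_simps vec.scale_right_distrib)
  from lincomb_eq_0[OF L this] show ?thesis
    by simp
qed

section \<open>Scalings: uniqueness and composition\<close>

lemma scaling_unique:
  assumes L: "L \<in> \<L>" and g: "scaling L M c g" and h: "scaling L M c h"
  shows "g = h"
proof (rule extensionalityI)
  show "g \<in> extensional (points_on L)" "h \<in> extensional (points_on L)"
    using g h by (auto simp: scaling_def)
  show "g q = h q" if q: "q \<in> points_on L" for q
    by (rule points_on_eq_pt[OF L q]) (use g h in \<open>auto simp: scaling_def\<close>)
qed

text \<open>The image of the point \<open>(1 : 1)\<close> is \<open>(1 : c)\<close>, which
  determines \<open>c\<close>.\<close>

lemma scaling_factor_unique:
  assumes "M \<in> \<L>" "scaling L M c g" "scaling L M d g"
  shows "c = d"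
proof -
  have "pt M 1 (c * 1) = pt M 1 (d * 1)"
    using assms(2,3) by (metis scaling_def prod.inject zero_neq_one)
  then show ?thesis
    using pt_1_eqD[OF assms(1)] by simp
qed

lemma scaling_ident: "L \<in> \<L> \<Longrightarrow> scaling L L 1 (\<lambda>q\<in>points_on L. q)"
  using pt_in_points_on by (auto simp: scaling_def)

lemma scaling_compose:
  assumes L: "L \<in> \<L>" and g: "scaling L M c g" and h: "scaling M N d h"
  shows "scaling L N (d * c) (compose (points_on L) h g)"
  unfolding scaling_def
proof (intro conjI allI impI)
  show "d * c \<noteq> 0"
    using g h by (simp add: scaling_def)
  show "compose (points_on L) h g \<in> extensional (points_on L)"
    by (rule compose_extensional)
  fix a b :: 'a assume ab: "(a, b) \<noteq> (0, 0)"
  have "(a, c * b) \<noteq> (0, 0)"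
    using ab g by (auto simp: scaling_def)
  then have "h (g (pt L a b)) = pt N a (d * (c * b))"
    using ab g h by (simp add: scaling_def)
  then show "compose (points_on L) h g (pt L a b) = pt N a (d * c * b)"
    using pt_in_points_on[OF L ab] by (simp add: compose_def mult.assoc)
qed

text \<open>A vector of \<open>L\<close> splits into a part in \<open>M\<close> and a part in
  \<open>N\<close>, and projection from \<open>N\<close> keeps the former. This multiplies the two
  coordinates by \<open>d\<close> and \<open>d'\<close>, of which only the ratio matters
  projectively.\<close>

lemma scaling_line_proj:
  assumes L: "L \<in> \<L>" "M \<in> \<L>" "N \<in> \<L>" "M \<noteq> N"
    and u: "u L = c *s u N + d *s u M" and v: "v L = c' *s v N + d' *s v M"
    and d: "d \<noteq> 0" "d' \<noteq> 0"
  shows "scaling L M (d' / d) (line_proj L M N)"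
  unfolding scaling_def
proof (intro conjI allI impI)
  show "d' / d \<noteq> 0"
    using d by simp
  show "line_proj L M N \<in> extensional (points_on L)"
    by (simp add: line_proj_def)
  fix a b :: 'a assume ab: "(a, b) \<noteq> (0, 0)"
  define z where "z = a *s u L + b *s v L"
  \<comment> \<open>The second coefficient is \<open>d' * b\<close>, written so that the common
    factor \<open>d\<close> can be cancelled by \<open>pt_scale\<close>.\<close>
  define m where "m = (d * a) *s u M + (d * (d' / d * b)) *s v M"
  define n where "n = (a * c) *s u N + (b * c') *s v N"
  have z: "z = m + n"
    unfolding z_def m_def n_def u v using d by (simp add: algebra_simps vec.scale_right_distrib)
  have m: "m \<in> M" and n: "n \<in> N"
    using L mem_iff unfolding m_def n_def by blast+
  \<comment> \<open>Modulo \<open>N\<close>, the span of \<open>z\<close> and \<open>N\<close>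
    consists of the multiples of \<open>m\<close>.\<close>
  have span: "w \<in> vec.span (vec.span {z} \<union> N) \<longleftrightarrow> (\<exists>t. w - t *s m \<in> N)" for w
  proof
    assume "w \<in> vec.span (vec.span {z} \<union> N)"
    then obtain p q where pq: "w = p + q" "p \<in> vec.span (vec.span {z})" "q \<in> vec.span N"
      unfolding vec.span_Un by blast
    then obtain t where t: "p = t *s z"
      by (auto simp: vec.span_span mem_span_single)
    have "q \<in> N"
      using pq(3) subspace[OF L(3)] by (simp add: vec.span_eq_iff[THEN iffD2])
    then have "t *s n + q \<in> N"
      using n subspace[OF L(3)] by (intro vec.subspace_add vec.subspace_scale)
    moreover have "w - t *s m = t *s n + q"
      unfolding pq t z by (simp add: vec.scale_right_distrib)
    ultimately show "\<exists>t. w - t *s m \<in> N"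
      by metis
  next
    assume "\<exists>t. w - t *s m \<in> N"
    then obtain t where t: "w - t *s m \<in> N" by blast
    have "w = t *s z + (w - t *s m - t *s n)"
      unfolding z by (simp add: vec.scale_right_distrib)
    moreover have "w - t *s m - t *s n \<in> N"
      using vec.subspace_diff[OF subspace[OF L(3)] t vec.subspace_scale[OF subspace[OF L(3)] n]] .
    then have "w - t *s m - t *s n \<in> vec.span (vec.span {z} \<union> N)"
      by (intro vec.span_base) auto
    moreover have "z \<in> vec.span {z}"
      by (intro vec.span_base) auto
    then have "t *s z \<in> vec.span (vec.span {z} \<union> N)"
      by (intro vec.span_scale vec.span_base) auto
    ultimately show "w \<in> vec.span (vec.span {z} \<union> N)"
      using vec.span_add by metis
  qed
  have "vec.span (vec.span {z} \<union> N) \<inter> M = vec.span {m}"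
  proof (intro equalityI subsetI)
    fix w assume w: "w \<in> vec.span (vec.span {z} \<union> N) \<inter> M"
    then obtain t where t: "w - t *s m \<in> N"
      using span by auto
    moreover have "w - t *s m \<in> M"
      using w m subspace[OF L(2)] by (intro vec.subspace_diff vec.subspace_scale) auto
    ultimately have "w - t *s m \<in> M \<inter> N"
      by simp
    then have "w = t *s m"
      unfolding Int_eq[OF L(2,3,4)] by simp
    then show "w \<in> vec.span {m}"
      by (auto simp: mem_span_single)
  next
    fix w assume "w \<in> vec.span {m}"
    then obtain t where "w = t *s m"
      by (auto simp: mem_span_single)
    then have "w - t *s m \<in> N" "w \<in> M"
      using m subspace[OF L(2)] subspace[OF L(3)]
      by (auto intro: vec.subspace_scale vec.subspace_0)
    then show "w \<in> vec.span (vec.span {z} \<union> N) \<inter> M"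
      using span by blast
  qed
  moreover have "line_proj L M N (pt L a b) = vec.span (pt L a b \<union> N) \<inter> M"
    using pt_in_points_on[OF L(1) ab] by (simp add: line_proj_def)
  ultimately have "line_proj L M N (pt L a b) = vec.span {m}"
    by (simp add: pt_def z_def)
  also have "\<dots> = pt M a (d' / d * b)"
    using pt_scale[OF d(1), of M a "d' / d * b"] by (simp only: pt_def m_def)
  finally show "line_proj L M N (pt L a b) = pt M a (d' / d * b)" .
qed

abbreviation "P \<equiv> \<L> - {L\<^sub>0}"

text \<open>Lines with equal abscissae would share the nonzero vector \<open>u L\<close>, contrary
  to skewness.\<close>

lemma inj_on_x: "inj_on x P"
proof (rule inj_onI, rule ccontr)
  fix L M assume LM: "L \<in> P" "M \<in> P" "x L = x M" "L \<noteq> M"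
  then have "u L = u M"
    using u_eq[of L] u_eq[of M] by simp
  then have "u L = 0"
    using LM uv_mem(1)[of L] uv_mem(1)[of M] Int_eq[of L M] by auto
  then show False
    using LM lincomb_eq_0[of L 1 0] by auto
qed

lemma inj_on_y: "inj_on y P"
proof (rule inj_onI, rule ccontr)
  fix L M assume LM: "L \<in> P" "M \<in> P" "y L = y M" "L \<noteq> M"
  then have "v L = v M"
    using v_eq[of L] v_eq[of M] by simp
  then have "v L = 0"
    using LM uv_mem(2)[of L] uv_mem(2)[of M] Int_eq[of L M] by auto
  then show False
    using LM lincomb_eq_0[of L 0 1] by auto
qed

section \<open>Scaling factors of the projections\<close>

lemma xy_neq: "L \<in> P \<Longrightarrow> M \<in> P \<Longrightarrow> L \<noteq> M \<Longrightarrow> x L - x M \<noteq> 0 \<and> y L - y M \<noteq> 0"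
  using inj_on_x inj_on_y by (auto dest: inj_onD)

text \<open>Subtracting the affine expressions of \<open>u M\<close> and \<open>u N\<close> and
  solving for \<open>u L\<^sub>0\<close> gives the coefficient \<open>1 / (x M - x N)\<close> at
  \<open>u M\<close>; the same holds for \<open>v\<close> and \<open>y\<close>, and the quotient is
  the inverse slope.\<close>

lemma scaling_from_base:
  assumes "M \<in> P" "N \<in> P" "M \<noteq> N"
  shows "scaling L\<^sub>0 M (1 / slope x y M N) (line_proj L\<^sub>0 M N)"
proof -
  note ne = xy_neq[OF assms]
  have "(x M - x N) *s u L\<^sub>0 = u M - u N" "(y M - y N) *s v L\<^sub>0 = v M - v N"
    using assms u_eq[of M] u_eq[of N] v_eq[of M] v_eq[of N] by (auto simp: algebra_simps)
  then have "(1 / (x M - x N)) *s ((x M - x N) *s u L\<^sub>0) = (1 / (x M - x N)) *s (u M - u N)"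
    "(1 / (y M - y N)) *s ((y M - y N) *s v L\<^sub>0) = (1 / (y M - y N)) *s (v M - v N)"
    by simp_all
  then have "u L\<^sub>0 = (- (1 / (x M - x N))) *s u N + (1 / (x M - x N)) *s u M"
    "v L\<^sub>0 = (- (1 / (y M - y N))) *s v N + (1 / (y M - y N)) *s v M"
    using ne by (simp_all add: vec.scale_right_diff_distrib)
  from scaling_line_proj[OF base _ _ _ this] show ?thesis
    using assms ne by (simp add: slope_def)
qed

lemma scaling_to_base:
  assumes "L \<in> P" "N \<in> P" "L \<noteq> N"
  shows "scaling L L\<^sub>0 (slope x y L N) (line_proj L L\<^sub>0 N)"
proof -
  note ne = xy_neq[OF assms]
  have "u L = 1 *s u N + (x L - x N) *s u L\<^sub>0" "v L = 1 *s v N + (y L - y N) *s v L\<^sub>0"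
    using assms u_eq[of L] u_eq[of N] v_eq[of L] v_eq[of N] by (auto simp: algebra_simps)
  from scaling_line_proj[OF _ base _ _ this] show ?thesis
    using assms ne by (auto simp: slope_def)
qed

text \<open>Projection from the line at infinity preserves the coordinates, because
  \<open>u M\<close> and \<open>v M\<close> both enter with coefficient 1.\<close>

lemma scaling_via_base:
  assumes "L \<in> P" "M \<in> P"
  shows "scaling L M 1 (line_proj L M L\<^sub>0)"
proof -
  have "u L = (x L - x M) *s u L\<^sub>0 + 1 *s u M" "v L = (y L - y M) *s v L\<^sub>0 + 1 *s v M"
    using assms u_eq[of L] u_eq[of M] v_eq[of L] v_eq[of M] by (auto simp: algebra_simps)
  from scaling_line_proj[OF _ _ base _ this] show ?thesis
    using assms by simp
qed

lemma scaling_off_base: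
  assumes "L \<in> P" "M \<in> P" "N \<in> P" "L \<noteq> N" "M \<noteq> N"
  shows "scaling L M (slope x y L N / slope x y M N) (line_proj L M N)"
proof -
  note ne = xy_neq[OF assms(1,3,4)] xy_neq[OF assms(2,3,5)]
  \<comment> \<open>Of three affine points on one transversal the first is an affine combination of
    the other two; its weight at \<open>p'\<close> is a quotient of coordinate differences.\<close>
  have aux: "p = (1 - (s - r) / (t - r)) *s q' + ((s - r) / (t - r)) *s p'"
    if "p = s *s w + g" "p' = t *s w + g" "q' = r *s w + g" "t - r \<noteq> 0"
    for p p' q' w g :: "'a ^ 4" and s t r
  proof -
    define k where "k = (s - r) / (t - r)"
    have k: "k * (t - r) = s - r"
      using that(4) by (simp add: k_def)
    have "(1 - k) *s q' + k *s p' = (r + k * (t - r)) *s w + g"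
      unfolding that(2,3) by (simp add: algebra_simps vec.scale_right_distrib)
    then show ?thesis
      unfolding k that(1) k_def[symmetric] by simp
  qed
  have "u L = (1 - (x L - x N) / (x M - x N)) *s u N + ((x L - x N) / (x M - x N)) *s u M"
    "v L = (1 - (y L - y N) / (y M - y N)) *s v N + ((y L - y N) / (y M - y N)) *s v M"
    by (rule aux; use assms ne u_eq v_eq in blast)+
  from scaling_line_proj[OF _ _ _ _ this] show ?thesis
    using assms ne by (simp add: slope_def mult.commute)
qed

lemma slope_neq_0: "L \<in> P \<Longrightarrow> M \<in> P \<Longrightarrow> L \<noteq> M \<Longrightarrow> slope x y L M \<noteq> 0"
  using xy_neq[of L M] by (simp add: slope_def)

section \<open>The multiplier group \<open>H\<close> of \<open>L\<^sub>0\<close>\<close>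

definition multipliers :: "'a set" where
  "multipliers = {c. \<exists>g. groupoid_arrow \<L> L\<^sub>0 L\<^sub>0 g \<and> scaling L\<^sub>0 L\<^sub>0 c g}"

lemma groupoid_arrow_scaling:
  "groupoid_arrow \<L> L M g \<Longrightarrow> L \<in> \<L> \<and> M \<in> \<L> \<and> (\<exists>c. scaling L M c g)"
proof (induction rule: groupoid_arrow.induct)
  case (proj L M N)
  \<comment> \<open>Which of the three lines, if any, is at infinity.\<close>
  consider "L = L\<^sub>0" | "M = L\<^sub>0" | "N = L\<^sub>0" | "L \<noteq> L\<^sub>0" "M \<noteq> L\<^sub>0" "N \<noteq> L\<^sub>0"
    by blast
  then show ?case
  proof cases
    case 1
    then show ?thesis
      using proj scaling_from_base[of M N] by blast
  next
    case 2
    then show ?thesis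
      using proj scaling_to_base[of L N] by blast
  next
    case 3
    then show ?thesis
      using proj scaling_via_base[of L M] by blast
  next
    case 4
    then show ?thesis
      using proj scaling_off_base[of L M N] by blast
  qed
next
  case (ident L)
  then show ?case
    using scaling_ident by blast
next
  case (comp L M f N g)
  then show ?case
    using scaling_compose by blast
qed

text \<open>A loop at \<open>L\<^sub>0\<close> and its scaling factor determine each other, so the
  group order can be counted in the field.\<close>

lemma bij_betw_multipliers:
  "\<exists>m. bij_betw m (carrier (vertex_group \<L> L\<^sub>0)) multipliers"
proof -
  let ?G = "carrier (vertex_group \<L> L\<^sub>0)"
  have G: "?G = {g. groupoid_arrow \<L> L\<^sub>0 L\<^sub>0 g}"
    by (simp add: vertex_group_def)
  then have "\<forall>g\<in>?G. \<exists>c. scaling L\<^sub>0 L\<^sub>0 c g"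
    using groupoid_arrow_scaling by blast
  then obtain m where m: "\<And>g. g \<in> ?G \<Longrightarrow> scaling L\<^sub>0 L\<^sub>0 (m g) g"
    by metis
  have "inj_on m ?G"
    by (rule inj_onI) (metis m scaling_unique[OF base])
  moreover have "m ` ?G = multipliers"
  proof (intro equalityI subsetI)
    fix c assume "c \<in> m ` ?G"
    then show "c \<in> multipliers"
      using m G by (auto simp: multipliers_def)
  next
    fix c assume "c \<in> multipliers"
    then obtain g where g: "g \<in> ?G" "scaling L\<^sub>0 L\<^sub>0 c g"
      by (auto simp: multipliers_def G)
    then have "m g = c"
      using m scaling_factor_unique[OF base] by blast
    then show "c \<in> m ` ?G"
      using g by blast
  qed
  ultimately show ?thesis
    by (auto simp: bij_betw_def)
qed

lemma one_in_multipliers: "1 \<in> multipliers"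
  using groupoid_arrow.ident[OF base] scaling_ident[OF base] by (auto simp: multipliers_def)

lemma zero_notin_multipliers: "0 \<notin> multipliers"
  by (simp add: multipliers_def scaling_def)

lemma mult_in_multipliers:
  "c \<in> multipliers \<Longrightarrow> d \<in> multipliers \<Longrightarrow> c * d \<in> multipliers"
  unfolding multipliers_def using groupoid_arrow.comp scaling_compose[OF base] by blast

text \<open>Going from \<open>L\<^sub>0\<close> to \<open>L\<close> by projection from
  \<open>N\<close> and returning by projection from \<open>M\<close> scales by this ratio.\<close>

lemma slope_ratio_in_multipliers:
  assumes "L \<in> P" "M \<in> P" "N \<in> P" "L \<noteq> M" "L \<noteq> N"
  shows "slope x y L M / slope x y L N \<in> multipliers"
proof -
  let ?g = "line_proj L\<^sub>0 L N" and ?h = "line_proj L L\<^sub>0 M"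
  have "groupoid_arrow \<L> L\<^sub>0 L ?g" "groupoid_arrow \<L> L L\<^sub>0 ?h"
    using assms base by (auto intro!: groupoid_arrow.proj)
  then have "groupoid_arrow \<L> L\<^sub>0 L\<^sub>0 (compose (points_on L\<^sub>0) ?h ?g)"
    by (rule groupoid_arrow.comp)
  moreover have "scaling L\<^sub>0 L\<^sub>0 (slope x y L M * (1 / slope x y L N)) (compose (points_on L\<^sub>0) ?h ?g)"
    using assms by (intro scaling_compose[OF base, where M = L] scaling_from_base scaling_to_base) auto
  ultimately show ?thesis
    by (auto simp: multipliers_def)
qed

text \<open>The factors come from a potential: an arrow from \<open>L\<close> to \<open>M\<close>
  scales by \<open>w L / w M\<close>. Such quotients telescope under composition and are 1 on
  loops.\<close>

lemma multipliers_trivial_if_collinear: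
  assumes slope: "\<And>L M. L \<in> P \<Longrightarrow> M \<in> P \<Longrightarrow> L \<noteq> M \<Longrightarrow> slope x y L M = m" and m: "m \<noteq> 0"
  shows "multipliers = {1}"
proof -
  \<comment> \<open>Chosen to match the factors \<open>1 / m\<close> out of
    \<open>L\<^sub>0\<close>, \<open>m\<close> into \<open>L\<^sub>0\<close> and 1 between other
    lines.\<close>
  define w where "w = (\<lambda>L. if L = L\<^sub>0 then 1 else m)"
  have w: "w L \<noteq> 0" for L
    using m by (simp add: w_def)
  have "L \<in> \<L> \<and> M \<in> \<L> \<and> scaling L M (w L / w M) g" if "groupoid_arrow \<L> L M g" for L M g
    using that
  proof (induction rule: groupoid_arrow.induct)
    case (proj L M N)
    consider "L = L\<^sub>0" | "M = L\<^sub>0" | "N = L\<^sub>0" | "L \<noteq> L\<^sub>0" "M \<noteq> L\<^sub>0" "N \<noteq> L\<^sub>0"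
      by blast
    then show ?case
    proof cases
      case 1
      then show ?thesis
        using proj scaling_from_base[of M N] slope[of M N] by (auto simp: w_def)
    next
      case 2
      then show ?thesis
        using proj scaling_to_base[of L N] slope[of L N] by (auto simp: w_def)
    next
      case 3
      then show ?thesis
        using proj scaling_via_base[of L M] m by (auto simp: w_def)
    next
      case 4
      then show ?thesis
        using proj scaling_off_base[of L M N] slope[of L N] slope[of M N] by (auto simp: w_def)
    qed
  next
    case (ident L)
    then show ?case
      using scaling_ident[of L] w[of L] by (metis divide_self)
  next
    case (comp L M g N h)
    then have "scaling L N (w M / w N * (w L / w M)) (compose (points_on L) h g)"
      using scaling_compose by blast
    then show ?case
      using comp w[of M] by simp
  qed
  then have "c = 1" if "c \<in> multipliers" for c
    using that w[of L\<^sub>0] scaling_factor_unique[OF base] by (fastforce simp: multipliers_def)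
  then show ?thesis
    using one_in_multipliers by auto
qed

lemma card_le:
  assumes fin: "finite \<L>" and card: "card \<L> \<ge> 3" and finM: "finite multipliers"
    and nontriv: "multipliers \<noteq> {1}"
  shows "card \<L> \<le> 2 * ((card multipliers - 1) * (card multipliers - 2)) + 2"
proof -
  \<comment> \<open>The line at infinity turns the \<open>+ 1\<close> of the affine bound into
    \<open>+ 2\<close>.\<close>
  have cardP: "card \<L> = card P + 1"
    using card_Suc_Diff1[OF fin base] by simp
  then have "\<not> card P \<le> Suc 0"
    using card by simp
  then obtain A B where AB: "A \<in> P" "B \<in> P" "A \<noteq> B"
    using fin by (subst (asm) card_le_Suc0_iff_eq) auto
  \<comment> \<open>Otherwise all points lie on the line \<open>A B\<close>, all slopes agree and
    the group is trivial.\<close>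
  have "\<exists>C\<in>P. C \<noteq> A \<and> slope x y A C \<noteq> slope x y A B"
  proof (rule ccontr)
    assume "\<not> ?thesis"
    then have *: "slope x y A C = slope x y A B" if "C \<in> P" "C \<noteq> A" for C
      using that by blast
    have "slope x y L M = slope x y A B" if LM: "L \<in> P" "M \<in> P" "L \<noteq> M" for L M
    proof (cases "L = A \<or> M = A")
      case True
      then show ?thesis
        using * LM slope_commute by metis
    next
      case False
      have "slope x y L A = slope x y A B" "slope x y A M = slope x y A B"
        using * LM False slope_commute[of x y L A] by auto
      then show ?thesis
        using xy_neq[OF LM] xy_neq[OF LM(1) AB(1)] xy_neq[OF AB(1) LM(2)] False
        by (intro slope_eq_trans[of x L A M]) auto
    qed
    then show False
      using multipliers_trivial_if_collinear slope_neq_0[OF AB] nontriv by blast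
  qed
  then obtain C where C: "C \<in> P" "A \<noteq> C" "slope x y A C \<noteq> slope x y A B"
    by blast
  have "card P \<le> 2 * ((card multipliers - 1) * (card multipliers - 2)) + 1"
    using fin
    by (intro card_noncollinear_le[OF _ inj_on_x inj_on_y finM one_in_multipliers _ AB(1,2) C(1) AB(3) C(2,3)]
        slope_ratio_in_multipliers) auto
  then show ?thesis
    using cardP by simp
qed

end

section \<open>Existence of the coordinates\<close>

lemma two_transversal_coordinates_exist:
  fixes \<L> :: "('a::field ^ 4) set set"
  assumes fin: "finite \<L>" and card: "card \<L> \<ge> 3" and skew: "skew_lines \<L>"
    and T: "is_transversal \<L> T\<^sub>1" "is_transversal \<L> T\<^sub>2" "T\<^sub>1 \<noteq> T\<^sub>2" and L\<^sub>0: "L\<^sub>0 \<in> \<L>"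
  obtains u v x y e f where "two_transversal_coordinates \<L> L\<^sub>0 u v x y e f"
proof -
  have "card (\<L> - {L\<^sub>0}) > 0"
    using card fin L\<^sub>0 by simp
  then obtain L\<^sub>1 where L\<^sub>1: "L\<^sub>1 \<in> \<L>" "L\<^sub>0 \<noteq> L\<^sub>1"
    by (metis DiffD1 DiffD2 card_gt_0_iff ex_in_conv insertCI)
  obtain u x e where u: "\<And>L. L \<in> \<L> \<Longrightarrow> u L \<in> L \<and> u L \<in> T\<^sub>1 \<and> u L \<noteq> 0"
    "\<And>L. L \<in> \<L> \<Longrightarrow> L \<noteq> L\<^sub>0 \<Longrightarrow> u L = x L *s u L\<^sub>0 + e"
    by (rule transversal_affine_coordinate[OF skew T(1) L\<^sub>0 L\<^sub>1]) blast
  obtain v y f where v: "\<And>L. L \<in> \<L> \<Longrightarrow> v L \<in> L \<and> v L \<in> T\<^sub>2 \<and> v L \<noteq> 0"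
    "\<And>L. L \<in> \<L> \<Longrightarrow> L \<noteq> L\<^sub>0 \<Longrightarrow> v L = y L *s v L\<^sub>0 + f"
    by (rule transversal_affine_coordinate[OF skew T(2) L\<^sub>0 L\<^sub>1]) blast
  have line: "proj_line T\<^sub>2" "\<And>L. L \<in> \<L> \<Longrightarrow> proj_line L"
    using T skew by (auto simp: is_transversal_def skew_lines_def)
  \<comment> \<open>The two vectors are nonzero and lie on transversals that meet only in 0.\<close>
  have indep: "indep_pair (u L) (v L)" if "L \<in> \<L>" for L
    using transversals_Int[OF fin card skew T] u(1)[OF that] v(1)[OF that]
    by (intro indep_pair_of_not_mem[OF line(1)]) auto
  have "two_transversal_coordinates \<L> L\<^sub>0 u v x y e f"
  proof
    show "L = vec.span {u L, v L}" if "L \<in> \<L>" for L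
      using proj_line_eq_span line indep u v that by blast
  qed (use L\<^sub>0 indep u v skew_lines_Int[OF skew] in auto)
  then show thesis
    by (rule that)
qed

subsection \<open>The bounds\<close>

text \<open>Monotonicity replaces \<open>g\<close> by \<open>r\<close>, and \<open>r \<ge> 3\<close>
  absorbs the factor 3. For \<open>r = 2\<close> that estimate fails, but both sides are 0.\<close>

lemma pred_mult_pred_le:
  fixes g r :: nat
  assumes "1 < g" "g \<le> r"
  shows "3 * ((real g - 1) * (real g - 2)) \<le> real r * (real r - 1) * (real r - 2)"
proof (cases "r = 2")
  case True
  then have "g = 2"
    using assms by simp
  then show ?thesis
    using True by simp
next
  case False
  then have r: "r \<ge> 3"
    using assms by linarith
  have "(real g - 1) * (real g - 2) \<le> (real r - 1) * (real r - 2)"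
    using assms by (intro mult_mono) auto
  moreover have "3 * ((real r - 1) * (real r - 2)) \<le> real r * ((real r - 1) * (real r - 2))"
    using r by (intro mult_right_mono mult_nonneg_nonneg) auto
  ultimately show ?thesis
    by (simp add: mult.assoc)
qed

theorem corollary3p5p2:
  fixes \<L> :: "('a::field ^ 4) set set"
    and L\<^sub>0 T\<^sub>1 T\<^sub>2 :: "('a ^ 4) set"
    and b r :: nat
  assumes "finite \<L>" and "card \<L> = b" and "b \<ge> 3"
    and "skew_lines \<L>"
    and "is_transversal \<L> T\<^sub>1" and "is_transversal \<L> T\<^sub>2" and "T\<^sub>1 \<noteq> T\<^sub>2"
    and "L\<^sub>0 \<in> \<L>"
    and "group_card (vertex_group \<L> L\<^sub>0) > 1"
    and "r \<ge> 1"
  shows "(real b > 2 * real r * (real r - 1) * (real r - 2) / 3 + 2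
            \<longrightarrow> group_card (vertex_group \<L> L\<^sub>0) > enat r) \<and>
         (int b > 2 * (\<Sum>m = 1..r. num_lines CHAR('a) m) + 2
            \<longrightarrow> group_card (vertex_group \<L> L\<^sub>0) > enat r)"
proof (cases "group_card (vertex_group \<L> L\<^sub>0) > enat r")
  \<comment> \<open>With a group of order at most \<open>r\<close>, both lower bounds on
    \<open>b\<close> are refuted.\<close>
  case False
  let ?G = "vertex_group \<L> L\<^sub>0"
  have finG: "finite (carrier ?G)"
    using False by (auto simp: group_card_def split: if_splits)
  obtain u v x y e f where "two_transversal_coordinates \<L> L\<^sub>0 u v x y e f"
    using two_transversal_coordinates_exist assms by metis
  then interpret two_transversal_coordinates \<L> L\<^sub>0 u v x y e f .
  define g where "g = card multipliers"
  obtain m where m: "bij_betw m (carrier ?G) multipliers"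
    using bij_betw_multipliers by blast
  have finM: "finite multipliers"
    using bij_betw_finite[OF m] finG by simp
  have card: "group_card ?G = enat g"
    using finG bij_betw_same_card[OF m] by (simp add: group_card_def Coset.order_def g_def)
  have g: "1 < g" "g \<le> r"
    using False assms(9) unfolding card by (simp_all add: one_enat_def)
  have "multipliers \<noteq> {1}"
    using g(1) by (auto simp: g_def)
  then have "b \<le> 2 * ((g - 1) * (g - 2)) + 2"
    using card_le[OF assms(1) assms(3)[folded assms(2)] finM] unfolding assms(2) g_def by blast
  then have "int b \<le> int (2 * ((g - 1) * (g - 2)) + 2)"
    by (rule of_nat_mono)
  also have "\<dots> = 2 * ((int g - 1) * (int g - 2)) + 2"
    using g(1) by (simp add: of_nat_diff)
  finally have b: "int b \<le> 2 * ((int g - 1) * (int g - 2)) + 2" .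
  have "(int g - 1) * (int g - 2) = (\<Sum>d | d dvd g. num_lines CHAR('a) d)"
    using not_CHAR_dvd_card[OF finM zero_notin_multipliers one_in_multipliers mult_in_multipliers] g(1)
    unfolding g_def by (intro sum_num_lines_divisors[symmetric]) auto
  \<comment> \<open>The divisors of \<open>g\<close> are among the numbers up to \<open>r\<close>,
    and the additional terms are nonnegative.\<close>
  also have "\<dots> \<le> (\<Sum>m = 1..r. num_lines CHAR('a) m)"
  proof (rule sum_mono2)
    have "0 < d \<and> d \<le> r" if "d dvd g" for d
      using that g dvd_imp_le[OF that] dvd_pos_nat[OF _ that] by simp
    then show "{d. d dvd g} \<subseteq> {1..r}"
      by (auto simp: Suc_le_eq)
  qed (simp_all add: num_lines_nonneg)
  finally have "int b \<le> 2 * (\<Sum>m = 1..r. num_lines CHAR('a) m) + 2"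
    using b by linarith
  \<comment> \<open>The cubic bound follows from the estimate in \<open>g\<close> directly, without
    the \<open>num_lines\<close>.\<close>
  moreover have "real b \<le> 2 * ((real g - 1) * (real g - 2)) + 2"
  proof -
    have "real_of_int (int b) \<le> real_of_int (2 * ((int g - 1) * (int g - 2)) + 2)"
      using b by (rule of_int_le_iff[THEN iffD2])
    then show ?thesis by simp
  qed
  then have "real b \<le> 2 * real r * (real r - 1) * (real r - 2) / 3 + 2"
    using pred_mult_pred_le[OF g] by (simp add: field_simps)
  ultimately show ?thesis
    by linarith
qed simp

end
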